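(* Let $\sigma$ be an irreducible normalized multiscale substitution scheme in $\mathbb{R}^d$. Then there exist $s>0$ and a tiling $\mathcal{S}\in\mathbb{X}^F_\sigma$ such that $F_s(\mathcal{S})=\mathcal{S}$.
   Context: Schemes. A tile in $\mathbb{R}^d$ is a bounded Lebesgue measurable set $T$ of positive measure $\mathrm{vol}\,T$ whose boundary has measure zero. A tessellation of $U\subset\mathbb{R}^d$ is a collection of tiles with pairwise disjoint interiors and union $U$; it is called a patch if $U$ is bounded ($U$ is then the support of the patch) and a tiling if $U=\mathbb{R}^d$. A multiscale substitution scheme $\sigma=(\tau_\sigma,\varrho_\sigma)$ consists of a finite list of prototiles $\tau_\sigma=(T_1,\dots,T_n)$ and, for each $i$, a tessellation $\varrho_\sigma(T_i)$ of $T_i$ all of whose tiles are translates of rescaled prototiles; the list of these rescaled prototiles is $\omega_\sigma(T_i)=(\alpha_{ij}^{(k)}T_j:\ j=1,\dots,n,\ k=1,\dots,k_{ij})$. Here $0<\alpha_{ij}^{(k)}<1$. A translate of $\alpha T_j$, $\alpha>0$, is a tile of type $j$ and scale $\alpha$. Standing assumptions: $\sigma$ is normalized, i.e. $\mathrm{vol}\,T_i=1$ for all $i$; distinct prototiles are geometrically different ($T_i$ is not a rescaled copy of $T_j$ for $i\ne j$), so the type of a tile is determined by the tile. Substitution semi-flow. For $t\ge 0$, $F_t(T_i)$ is the patch supported on $e^tT_i$ obtained by starting with $e^tT_i$ and repeatedly substituting (according to the rescaled rule $\varrho_\sigma$) every tile of volume $>1$, until all tiles have volume $\le 1$. In the same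 way $F_t$ is defined on every tile $T$ that is a translate of $\alpha T_i$ with $0<\alpha\le 1$ ($F_t(T)$ is supported on $e^tT$), on patches of such tiles, and on tilings by such tiles (tile by tile). $\sigma$ is irreducible if for all $i,j$ there is $t>0$ such that $F_t(T_i)$ contains a tile of type $j$. Tiling space. Position each $T_i$ so that the origin is an interior point. Let $\mathscr{P}_\sigma=\{F_t(T_i): t\ge0,\ i=1,\dots,n\}$. Identify a patch or tiling with the closed set which is the union of the boundaries of its tiles. On closed subsets of $\mathbb{R}^d$ use the metric $D(A_1,A_2)=\inf(\{r>0: A_1\cap B(0,1/r)\subset A_2^{+r},\ A_2\cap B(0,1/r)\subset A_1^{+r}\}\cup\{1\})$, where $A^{+r}$ is the $r$-neighborhood of $A$ and $B(x,R)$ is the open Euclidean ball. The multiscale tiling space $\mathbb{X}^F_\sigma$ is the set of all tilings $\mathcal{T}$ of $\mathbb{R}^d$ such that every sub-patch of $\mathcal{T}$ is a limit, with respect to $D$, of translated sub-patches of elements of $\mathscr{P}_\sigma$. Every tile of every $\mathcal{T}\in\mathbb{X}^F_\sigma$ is a rescaled copy (of scale at most $1$) of a prototile, and $F_t$ maps $\mathbb{X}_\sigma^F$ to itself. *)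

theory Defs
  imports "HOL-Analysis.Analysis" "HOL-Library.While_Combinator"
begin

section \<open>Tiles and tessellations\<close>

definition tile :: "'a::euclidean_space set \<Rightarrow> bool" where
  "tile T \<longleftrightarrow> bounded T \<and> T \<in> sets lebesgue \<and> measure lebesgue T > 0
     \<and> frontier T \<in> null_sets lebesgue"

text \<open>A tile has nonempty interior, so members of a collection with pairwise disjoint interiors
  cannot be repeated, and a set of tiles serves as a collection of tiles.\<close>

definition tessellation :: "'a::euclidean_space set set \<Rightarrow> 'a set \<Rightarrow> bool" where
  "tessellation P U \<longleftrightarrow> (\<forall>T\<in>P. tile T)
     \<and> pairwise (\<lambda>S T. interior S \<inter> interior T = {}) P \<and> \<Union>P = U"

definition patch :: "'a::euclidean_space set set \<Rightarrow> bool" where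
  "patch P \<longleftrightarrow> (\<exists>U. tessellation P U \<and> bounded U)"

definition tiling :: "'a::euclidean_space set set \<Rightarrow> bool" where
  "tiling P \<longleftrightarrow> tessellation P UNIV"

definition sub_patch :: "'a::euclidean_space set set \<Rightarrow> 'a set set \<Rightarrow> bool" where
  "sub_patch Q P \<longleftrightarrow> Q \<subseteq> P \<and> patch Q"

definition rescale :: "real \<Rightarrow> 'a::euclidean_space set \<Rightarrow> 'a set" where
  "rescale \<alpha> A = (\<lambda>x. \<alpha> *\<^sub>R x) ` A"

definition translate :: "'a::euclidean_space \<Rightarrow> 'a set \<Rightarrow> 'a set" where
  "translate v A = (\<lambda>x. v + x) ` A"

section \<open>Multiscale substitution schemes\<close>

text \<open>The prototiles \<open>T\<^sub>1, \<dots>, T\<^sub>n\<close> are numbered from \<open>0\<close>;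
  \<open>subst_rule \<sigma> i\<close> is the tessellation of the prototile with number \<open>i\<close>
  and is irrelevant for \<open>i \<ge> n\<close>.\<close>

record 'a scheme =
  prototiles :: "'a set list"
  subst_rule :: "nat \<Rightarrow> 'a set set"

abbreviation num_types :: "'a scheme \<Rightarrow> nat" where
  "num_types \<sigma> \<equiv> length (prototiles \<sigma>)"

abbreviation prototile :: "'a scheme \<Rightarrow> nat \<Rightarrow> 'a set" where
  "prototile \<sigma> i \<equiv> prototiles \<sigma> ! i"

definition tile_of_type_scale ::
  "'a::euclidean_space scheme \<Rightarrow> nat \<Rightarrow> real \<Rightarrow> 'a set \<Rightarrow> bool" where
  "tile_of_type_scale \<sigma> j \<alpha> T \<longleftrightarrow>
     j < num_types \<sigma> \<and> \<alpha> > 0 \<and> (\<exists>v. T = translate v (rescale \<alpha> (prototile \<sigma> j)))"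

text \<open>Finiteness of the tessellations is part of the requirement that the rescaled prototiles
  occurring in them form a finite list.\<close>

definition substitution_scheme :: "'a::euclidean_space scheme \<Rightarrow> bool" where
  "substitution_scheme \<sigma> \<longleftrightarrow> num_types \<sigma> \<ge> 1 \<and>
     (\<forall>i<num_types \<sigma>. tile (prototile \<sigma> i)
        \<and> tessellation (subst_rule \<sigma> i) (prototile \<sigma> i)
        \<and> finite (subst_rule \<sigma> i)
        \<and> (\<forall>S\<in>subst_rule \<sigma> i. \<exists>j \<alpha>. \<alpha> < 1 \<and> tile_of_type_scale \<sigma> j \<alpha> S))"

definition normalized :: "'a::euclidean_space scheme \<Rightarrow> bool" where
  "normalized \<sigma> \<longleftrightarrow> (\<forall>i<num_types \<sigma>. measure lebesgue (prototile \<sigma> i) = 1)"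

text \<open>Copies are taken up to translation: this is what makes the type of a tile
  (a translate of a rescaled prototile) depend on the tile only.\<close>

definition geometrically_different :: "'a::euclidean_space scheme \<Rightarrow> bool" where
  "geometrically_different \<sigma> \<longleftrightarrow>
     (\<forall>i<num_types \<sigma>. \<forall>j<num_types \<sigma>. i \<noteq> j \<longrightarrow>
        (\<nexists>\<alpha>. tile_of_type_scale \<sigma> j \<alpha> (prototile \<sigma> i)))"

definition origin_interior :: "'a::euclidean_space scheme \<Rightarrow> bool" where
  "origin_interior \<sigma> \<longleftrightarrow> (\<forall>i<num_types \<sigma>. 0 \<in> interior (prototile \<sigma> i))"

section \<open>The substitution semi-flow\<close>

text \<open>For geometrically different normalized prototiles, \<open>j\<close>, \<open>\<alpha>\<close> and \<open>v\<close> below are determined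
  by the tile \<open>T\<close>, so the set comprehension collects one copy of \<open>subst_rule \<sigma> j\<close>.\<close>

definition subst_tile :: "'a::euclidean_space scheme \<Rightarrow> 'a set \<Rightarrow> 'a set set" where
  "subst_tile \<sigma> T =
     {translate v (rescale \<alpha> S) | j \<alpha> v S.
        j < num_types \<sigma> \<and> \<alpha> > 0 \<and> T = translate v (rescale \<alpha> (prototile \<sigma> j))
        \<and> S \<in> subst_rule \<sigma> j}"

definition subst_large :: "'a::euclidean_space scheme \<Rightarrow> 'a set set \<Rightarrow> 'a set set" where
  "subst_large \<sigma> P =
     {T\<in>P. measure lebesgue T \<le> 1} \<union> (\<Union>T\<in>{T\<in>P. measure lebesgue T > 1}. subst_tile \<sigma> T)"

text \<open>The loop terminates when \<open>T\<close> is a rescaled copy of a prototile, because the finitely many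
  scales occurring in the substitution rule are less than \<open>1\<close>.\<close>

definition flow_tile :: "'a::euclidean_space scheme \<Rightarrow> real \<Rightarrow> 'a set \<Rightarrow> 'a set set" where
  "flow_tile \<sigma> t T =
     while (\<lambda>P. \<exists>S\<in>P. measure lebesgue S > 1) (subst_large \<sigma>) {rescale (exp t) T}"

definition flow :: "'a::euclidean_space scheme \<Rightarrow> real \<Rightarrow> 'a set set \<Rightarrow> 'a set set" where
  "flow \<sigma> t P = (\<Union>T\<in>P. flow_tile \<sigma> t T)"

definition irreducible_scheme :: "'a::euclidean_space scheme \<Rightarrow> bool" where
  "irreducible_scheme \<sigma> \<longleftrightarrow>
     (\<forall>i<num_types \<sigma>. \<forall>j<num_types \<sigma>. \<exists>t>0.
        \<exists>S\<in>flow_tile \<sigma> t (prototile \<sigma> i). \<exists>\<alpha>. tile_of_type_scale \<sigma> j \<alpha> S)"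

section \<open>The tiling space\<close>

definition generating_patches :: "'a::euclidean_space scheme \<Rightarrow> 'a set set set" where
  "generating_patches \<sigma> = {flow_tile \<sigma> t (prototile \<sigma> i) | t i. t \<ge> 0 \<and> i < num_types \<sigma>}"

definition boundary_set :: "'a::euclidean_space set set \<Rightarrow> 'a set" where
  "boundary_set P = (\<Union>T\<in>P. frontier T)"

definition nbhd :: "real \<Rightarrow> 'a::euclidean_space set \<Rightarrow> 'a set" where
  "nbhd r A = (\<Union>a\<in>A. ball a r)"

definition set_dist :: "'a::euclidean_space set \<Rightarrow> 'a set \<Rightarrow> real" where
  "set_dist A B =
     Inf ({r. r > 0 \<and> A \<inter> ball 0 (1 / r) \<subseteq> nbhd r B \<and> B \<inter> ball 0 (1 / r) \<subseteq> nbhd r A} \<union> {1})"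

definition limit_of_generated :: "'a::euclidean_space scheme \<Rightarrow> 'a set set \<Rightarrow> bool" where
  "limit_of_generated \<sigma> P \<longleftrightarrow>
     (\<exists>Q v. (\<forall>k::nat. \<exists>G\<in>generating_patches \<sigma>. sub_patch (Q k) G)
        \<and> (\<lambda>k. set_dist (boundary_set (translate (v k) ` Q k)) (boundary_set P))
            \<longlonglongrightarrow> 0)"

text \<open>The boundary set does not tell apart, say, a tile and its interior. That the members of the
  tiling space consist of rescaled copies of prototiles of scale at most \<open>1\<close>, the tiles on which the
  semi-flow is defined, is therefore made explicit.\<close>

definition tiling_space :: "'a::euclidean_space scheme \<Rightarrow> 'a set set set" where
  "tiling_space \<sigma> =
     {\<T>. tiling \<T> \<and> (\<forall>T\<in>\<T>. \<exists>j \<alpha>. \<alpha> \<le> 1 \<and> tile_of_type_scale \<sigma> j \<alpha> T)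
        \<and> (\<forall>P. sub_patch P \<T> \<longrightarrow> limit_of_generated \<sigma> P)}"

end

theory Submission
  imports Defs
begin

text \<open>
The tiling is the increasing union of the patches \<open>F\<^bsub>ks\<^esub>(T)\<close>, \<open>k = 0, 1, 2, \<dots>\<close>, for a
translate \<open>T\<close> of a prototile that reproduces itself under \<open>F\<^sub>s\<close> around an interior point.

Inflate a prototile \<open>T\<^sub>i\<close> by \<open>e\<^sup>t\<close>, where \<open>t\<close> is large. The patch \<open>F\<^sub>t(T\<^sub>i)\<close> has tiles of bounded
diameter, so a tile of it that contains the origin lies in a small ball around the origin, deep inside \<open>e\<^sup>tT\<^sub>i\<close>.
By irreducibility some descendant of this tile has type \<open>i\<close>. It is a smaller similar copy of
\<open>e\<^sup>tT\<^sub>i\<close>, say the image of \<open>e\<^sup>tT\<^sub>i\<close> under \<open>x \<mapsto> w + \<gamma>x\<close>, and this map sends the ball into itself.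
Moving its fixed point, which is interior, to the origin gives a translate \<open>T\<close> of \<open>T\<^sub>i\<close> that has the
origin in its interior and \<open>\<gamma>T\<close> among its descendants (\<open>self_similar_descendant\<close>).

Put \<open>s = - ln \<gamma>\<close>. The line of descent from \<open>e\<^sup>sT\<close> to \<open>e\<^sup>s\<gamma>T = T\<close> consists of tiles of volume
greater than 1 until it reaches \<open>T\<close>, which has volume 1, hence \<open>T \<in> F\<^sub>s(T)\<close>. By the semi-flow
property \<open>F\<^sub>s \<circ> F\<^sub>t = F\<^bsub>s+t\<^esub>\<close> (\<open>flow_flow_tile\<close>) the patches \<open>F\<^bsub>ks\<^esub>(T)\<close> increase with \<open>k\<close>, and
\<open>F\<^sub>s\<close> maps each to the next, so their union is fixed by \<open>F\<^sub>s\<close>. Their supports \<open>e\<^bsup>ks\<^esup>T\<close> exhaust the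
space because the origin is interior to \<open>T\<close>, so the union is a tiling. A bounded sub-patch of it is
already contained in one \<open>F\<^bsub>ks\<^esub>(T)\<close>, a translate of a generating patch, and is therefore the limit
of a constant sequence.

The semi-flow is defined by a loop. It is analysed through the genealogy of tiles: the loop returns
exactly the tiles of volume at most 1 that are reached through ancestors of volume greater than 1
(\<open>while_subst_large\<close>).
\<close>

section \<open>Similar copies of sets\<close>

abbreviation vol :: "'a::euclidean_space set \<Rightarrow> real" where
  "vol \<equiv> measure lebesgue"

definition copy :: "'a::euclidean_space \<Rightarrow> real \<Rightarrow> 'a set \<Rightarrow> 'a set" where
  "copy v \<alpha> S = translate v (rescale \<alpha> S)"

lemmas copy_fold = copy_def[symmetric]

lemma copy_eq_image: "copy v \<alpha> S = (\<lambda>x. v + \<alpha> *\<^sub>R x) ` S"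
  by (simp add: copy_def translate_def rescale_def image_image)

lemma copy_copy: "copy v \<alpha> (copy w \<beta> S) = copy (v + \<alpha> *\<^sub>R w) (\<alpha> * \<beta>) S"
  by (simp add: copy_eq_image image_image algebra_simps)

lemma copy_0_1: "copy 0 1 S = S"
  by (simp add: copy_eq_image)

lemma rescale_eq_copy: "rescale \<alpha> S = copy 0 \<alpha> S"
  by (simp add: copy_eq_image rescale_def)

lemma translate_eq_copy: "translate v S = copy v 1 S"
  by (simp add: copy_eq_image translate_def)

lemma copy_inverse:
  assumes "\<alpha> \<noteq> 0"
  shows "copy (- (1 / \<alpha>) *\<^sub>R v) (1 / \<alpha>) (copy v \<alpha> S) = S"
    and "copy v \<alpha> (copy (- (1 / \<alpha>) *\<^sub>R v) (1 / \<alpha>) S) = S"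
  using assms by (simp_all add: copy_copy copy_0_1)

lemma inj_copy_map: "\<alpha> \<noteq> 0 \<Longrightarrow> inj (\<lambda>x::'a::real_vector. v + \<alpha> *\<^sub>R x)"
  by (simp add: inj_on_def)

lemma vol_copy: "vol (copy v \<alpha> S) = \<bar>\<alpha>\<bar> ^ DIM('a) * vol S"
  for S :: "'a::euclidean_space set"
  using measure_lebesgue_affine[of \<alpha> v S] by (simp add: copy_eq_image add.commute)

lemma interior_copy: "\<alpha> \<noteq> 0 \<Longrightarrow> interior (copy v \<alpha> S) = copy v \<alpha> (interior S)"
  by (simp add: copy_def translate_def rescale_def interior_translation interior_injective_linear_image
      linear_scale_self inj_on_def)

lemma frontier_copy: "\<alpha> \<noteq> 0 \<Longrightarrow> frontier (copy v \<alpha> S) = copy v \<alpha> (frontier S)"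
proof -
  assume "\<alpha> \<noteq> 0"
  have "closure (copy v \<alpha> S) = copy v \<alpha> (closure S)"
    by (simp add: copy_def translate_def rescale_def closure_translation closure_scaleR)
  moreover have "copy v \<alpha> (A - B) = copy v \<alpha> A - copy v \<alpha> B" for A B
    unfolding copy_eq_image using \<open>\<alpha> \<noteq> 0\<close> by (rule image_set_diff[OF inj_copy_map])
  ultimately show ?thesis
    using \<open>\<alpha> \<noteq> 0\<close> by (simp only: frontier_def interior_copy not_False_eq_True)
qed

lemma tile_copy:
  assumes "tile T" "\<alpha> > 0"
  shows "tile (copy v \<alpha> T)"
proof -
  have "bounded (copy v \<alpha> T)"
    using assms by (simp add: tile_def copy_def translate_def rescale_def bounded_scaling bounded_translation)
  moreover have meas: "copy v \<alpha> A \<in> sets lebesgue" if "A \<in> sets lebesgue" for A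
  proof -
    have "copy v \<alpha> A = translate v ((*\<^sub>R) (1 / \<alpha>) -` A \<inter> space lebesgue)"
    proof -
      have "rescale \<alpha> A = (*\<^sub>R) (1 / \<alpha>) -` A"
        using assms(2) by (auto simp: rescale_def image_iff intro!: bexI[of _ "(1 / \<alpha>) *\<^sub>R _"])
      then show ?thesis by (simp add: copy_def)
    qed
    moreover have "(*\<^sub>R) (1 / \<alpha>) -` A \<inter> space lebesgue \<in> sets lebesgue"
      using that by (rule measurable_sets[OF lebesgue_measurable_scaling])
    ultimately show ?thesis
      unfolding translate_def by (simp only: lebesgue_sets_translation)
  qed
  moreover have "frontier (copy v \<alpha> T) \<in> null_sets lebesgue"
  proof -
    have "emeasure lebesgue (copy v \<alpha> (frontier T)) = 0"
      using emeasure_lebesgue_affine[of \<alpha> v "frontier T"] assms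
      unfolding copy_eq_image by (auto simp: tile_def null_sets_def add.commute)
    then show ?thesis
      using assms meas[of "frontier T"]
      by (simp add: tile_def frontier_copy null_setsI null_setsD2)
  qed
  ultimately show ?thesis
    using assms by (simp add: tile_def vol_copy)
qed

lemma tessellation_copy:
  assumes "tessellation P U" "\<alpha> > 0"
  shows "tessellation (copy v \<alpha> ` P) (copy v \<alpha> U)"
  unfolding tessellation_def
proof (intro conjI)
  show "\<forall>T\<in>copy v \<alpha> ` P. tile T"
    using assms by (auto simp: tessellation_def tile_copy)
  show "pairwise (\<lambda>S T. interior S \<inter> interior T = {}) (copy v \<alpha> ` P)"
  proof (rule pairwise_imageI)
    fix S T assume "S \<in> P" "T \<in> P" "S \<noteq> T"
    then have "interior S \<inter> interior T = {}"
      using assms by (auto simp: tessellation_def pairwise_def)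
    then show "interior (copy v \<alpha> S) \<inter> interior (copy v \<alpha> T) = {}"
      using assms(2) inj_copy_map[of \<alpha> v]
      by (simp only: interior_copy less_imp_neq[symmetric] not_False_eq_True)
         (simp add: copy_eq_image flip: image_Int)
  qed
  show "\<Union> (copy v \<alpha> ` P) = copy v \<alpha> U"
    using assms by (auto simp: tessellation_def copy_eq_image)
qed

text \<open>Repeating the translation would move a point of the set arbitrarily far away.\<close>

lemma translate_fixes_bounded_imp_0:
  fixes T :: "'a::euclidean_space set"
  assumes "bounded T" "T \<noteq> {}" "translate u T = T"
  shows "u = 0"
proof (rule ccontr)
  assume "u \<noteq> 0"
  obtain x where x: "x \<in> T" using assms by auto
  have iter: "x + real n *\<^sub>R u \<in> T" for n
  proof (induction n)
    case (Suc n)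
    then have "u + (x + real n *\<^sub>R u) \<in> T"
      using assms(3) by (auto simp: translate_def)
    then show ?case by (simp add: algebra_simps)
  qed (simp add: x)
  obtain B where B: "\<And>y. y \<in> T \<Longrightarrow> norm y \<le> B"
    using assms(1) by (auto simp: bounded_iff)
  obtain n where n: "(B + norm x + 1) / norm u < real n"
    using reals_Archimedean2 by blast
  then have "B + norm x + 1 < real n * norm u"
    using \<open>u \<noteq> 0\<close> by (simp add: field_simps)
  moreover have "norm (real n *\<^sub>R u) - norm x \<le> norm (x + real n *\<^sub>R u)"
    by (metis add.commute norm_diff_ineq)
  ultimately show False
    using B[OF iter[of n]] by simp
qed

section \<open>Refining tessellations\<close>

lemma tile_interior_nonempty:
  assumes "tile T" shows "interior T \<noteq> {}"
proof
  assume "interior T = {}"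
  then have "T \<subseteq> frontier T"
    using closure_subset by (auto simp: frontier_def)
  moreover have "frontier T \<in> null_sets lebesgue"
    using assms by (simp add: tile_def)
  ultimately have "T \<in> null_sets lebesgue"
    using assms by (metis null_sets_subset tile_def)
  then show False
    using assms by (auto simp: tile_def measure_def null_sets_def)
qed

text \<open>Outside the interiors of the covering tiles only their boundaries are left, a null set, which
  cannot contain the nonempty open interior of a tile.\<close>

lemma tile_meets_cover:
  assumes "tile S" "finite P" "\<forall>T\<in>P. tile T" "S \<subseteq> \<Union>P"
  shows "\<exists>T\<in>P. interior S \<inter> interior T \<noteq> {}"
proof (rule ccontr)
  assume "\<not> ?thesis"
  then have *: "interior S \<inter> interior T = {}" if "T \<in> P" for T using that by blast
  have "interior S \<subseteq> (\<Union>T\<in>P. frontier T)"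
  proof
    fix x assume x: "x \<in> interior S"
    then obtain T where T: "T \<in> P" "x \<in> T" using assms(4) interior_subset by blast
    then have "x \<in> frontier T"
      using * x closure_subset by (auto simp: frontier_def)
    then show "x \<in> (\<Union>T\<in>P. frontier T)" using T by blast
  qed
  moreover have "(\<Union>T\<in>P. frontier T) \<in> null_sets lebesgue"
    using assms by (intro null_sets.finite_UN) (auto simp: tile_def)
  ultimately have "negligible (interior S)"
    by (metis negligible_iff_null_sets negligible_subset)
  then show False
    using tile_interior_nonempty[OF assms(1)] open_not_negligible open_interior by blast
qed

lemma tessellation_refine:
  assumes P: "tessellation P U" and R: "\<And>T. T \<in> P \<Longrightarrow> tessellation (R T) T"
  shows "tessellation (\<Union>T\<in>P. R T) U"
  unfolding tessellation_def
proof (intro conjI)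
  show "\<forall>S\<in>\<Union>T\<in>P. R T. tile S"
    using R by (auto simp: tessellation_def)
  show "\<Union> (\<Union>T\<in>P. R T) = U"
    using P R by (auto simp: tessellation_def) blast+
  show "pairwise (\<lambda>S T. interior S \<inter> interior T = {}) (\<Union>T\<in>P. R T)"
  proof (rule pairwiseI)
    fix S S' assume "S \<in> (\<Union>T\<in>P. R T)" "S' \<in> (\<Union>T\<in>P. R T)" "S \<noteq> S'"
    then obtain T T' where T: "T \<in> P" "T' \<in> P" "S \<in> R T" "S' \<in> R T'" by blast
    show "interior S \<inter> interior S' = {}"
    proof (cases "T = T'")
      case True
      then show ?thesis
        using T \<open>S \<noteq> S'\<close> R[of T] by (auto simp: tessellation_def pairwise_def)
    next
      case False
      then have "interior T \<inter> interior T' = {}"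
        using T P by (auto simp: tessellation_def pairwise_def)
      moreover have "S \<subseteq> T" "S' \<subseteq> T'"
        using T R by (auto simp: tessellation_def)
      ultimately show ?thesis
        using interior_mono by blast
    qed
  qed
qed

lemma tessellation_singleton: "tile T \<Longrightarrow> tessellation {T} T"
  by (simp add: tessellation_def)

section \<open>The genealogy of tiles\<close>

definition child_rel :: "'a::euclidean_space scheme \<Rightarrow> ('a set \<times> 'a set) set" where
  "child_rel \<sigma> = {(T, S). S \<in> subst_tile \<sigma> T}"

text \<open>The generations that the loop of the semi-flow produces: only tiles of volume greater than 1
  have children.\<close>

definition large_child_rel :: "'a::euclidean_space scheme \<Rightarrow> ('a set \<times> 'a set) set" where
  "large_child_rel \<sigma> = {(T, S). vol T > 1 \<and> S \<in> subst_tile \<sigma> T}"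

text \<open>A description of the result of the loop that does not depend on the order of the
  substitutions.\<close>

definition stopped :: "'a::euclidean_space scheme \<Rightarrow> 'a set \<Rightarrow> 'a set set" where
  "stopped \<sigma> T = {S. (T, S) \<in> (large_child_rel \<sigma>)\<^sup>* \<and> vol S \<le> 1}"

definition scheme_tile :: "'a::euclidean_space scheme \<Rightarrow> 'a set \<Rightarrow> bool" where
  "scheme_tile \<sigma> T \<longleftrightarrow> (\<exists>j \<alpha>. tile_of_type_scale \<sigma> j \<alpha> T)"

lemma scheme_tile_iff:
  "scheme_tile \<sigma> T \<longleftrightarrow> (\<exists>j \<alpha> v. j < num_types \<sigma> \<and> \<alpha> > 0 \<and> T = copy v \<alpha> (prototile \<sigma> j))"
  by (auto simp: scheme_tile_def tile_of_type_scale_def copy_fold)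

lemma scheme_tile_copy:
  assumes "scheme_tile \<sigma> T" "\<alpha> > 0" shows "scheme_tile \<sigma> (copy v \<alpha> T)"
proof -
  obtain j \<beta> w where "j < num_types \<sigma>" "\<beta> > 0" "T = copy w \<beta> (prototile \<sigma> j)"
    using assms(1) by (auto simp: scheme_tile_iff)
  then show ?thesis
    using assms(2) unfolding scheme_tile_iff copy_copy by (metis copy_copy mult_pos_pos)
qed

lemma prototile_scheme_tile: "j < num_types \<sigma> \<Longrightarrow> scheme_tile \<sigma> (prototile \<sigma> j)"
  unfolding scheme_tile_iff by (metis copy_0_1 zero_less_one)

lemma subst_tile_copyI:
  assumes "S \<in> subst_tile \<sigma> T" "\<alpha> > 0"
  shows "copy v \<alpha> S \<in> subst_tile \<sigma> (copy v \<alpha> T)"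
proof -
  obtain j \<beta> w S0 where "j < num_types \<sigma>" "\<beta> > 0" "T = copy w \<beta> (prototile \<sigma> j)"
    "S0 \<in> subst_rule \<sigma> j" "S = copy w \<beta> S0"
    using assms(1) by (auto simp: subst_tile_def copy_fold)
  then show ?thesis
    using assms(2) unfolding subst_tile_def copy_fold
    by (intro CollectI exI[of _ j] exI[of _ "\<alpha> * \<beta>"] exI[of _ "v + \<alpha> *\<^sub>R w"] exI[of _ S0])
       (simp add: copy_copy)
qed

lemma subst_tile_copy:
  assumes "\<alpha> > 0"
  shows "subst_tile \<sigma> (copy v \<alpha> T) = copy v \<alpha> ` subst_tile \<sigma> T"
proof
  show "copy v \<alpha> ` subst_tile \<sigma> T \<subseteq> subst_tile \<sigma> (copy v \<alpha> T)"
    using subst_tile_copyI[OF _ assms] by blast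
  show "subst_tile \<sigma> (copy v \<alpha> T) \<subseteq> copy v \<alpha> ` subst_tile \<sigma> T"
  proof
    fix S assume "S \<in> subst_tile \<sigma> (copy v \<alpha> T)"
    then have "copy (- (1 / \<alpha>) *\<^sub>R v) (1 / \<alpha>) S
        \<in> subst_tile \<sigma> (copy (- (1 / \<alpha>) *\<^sub>R v) (1 / \<alpha>) (copy v \<alpha> T))"
      using assms by (intro subst_tile_copyI) auto
    then show "S \<in> copy v \<alpha> ` subst_tile \<sigma> T"
      using assms copy_inverse[of \<alpha> v] by (metis imageI less_irrefl)
  qed
qed

lemma descendant_copy:
  assumes "(T, S) \<in> (child_rel \<sigma>)\<^sup>*" "\<alpha> > 0"
  shows "(copy v \<alpha> T, copy v \<alpha> S) \<in> (child_rel \<sigma>)\<^sup>*"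
  using assms(1)
proof induction
  case (step S S')
  then show ?case
    using subst_tile_copyI[of S' \<sigma> S \<alpha> v] assms(2)
    by (auto simp: child_rel_def intro: rtrancl_into_rtrancl)
qed simp

text \<open>Inflation keeps the volumes of the ancestors above the threshold; contraction need not.\<close>

lemma large_descendant_copy:
  assumes "(T, S) \<in> (large_child_rel \<sigma>)\<^sup>*" "\<alpha> \<ge> 1"
  shows "(copy v \<alpha> T, copy v \<alpha> S) \<in> (large_child_rel \<sigma>)\<^sup>*"
  using assms(1)
proof induction
  case (step S S')
  have "vol S > 1" "S' \<in> subst_tile \<sigma> S" using step by (auto simp: large_child_rel_def)
  moreover have "vol (copy v \<alpha> S) \<ge> 1 * vol S"
    unfolding vol_copy using assms(2) by (intro mult_right_mono) auto
  ultimately have "(copy v \<alpha> S, copy v \<alpha> S') \<in> large_child_rel \<sigma>"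
    using subst_tile_copyI[of S' \<sigma> S \<alpha> v] assms(2) by (simp add: large_child_rel_def)
  then show ?case using step by (blast intro: rtrancl_into_rtrancl)
qed simp

lemma large_descendant_imp_descendant:
  "(T, S) \<in> (large_child_rel \<sigma>)\<^sup>* \<Longrightarrow> (T, S) \<in> (child_rel \<sigma>)\<^sup>*"
  by (rule subsetD[OF rtrancl_mono]) (auto simp: large_child_rel_def child_rel_def)

lemma stopped_small: "vol T \<le> 1 \<Longrightarrow> stopped \<sigma> T = {T}"
  by (auto simp: stopped_def large_child_rel_def elim: converse_rtranclE)

lemma stopped_large:
  assumes "vol T > 1" shows "stopped \<sigma> T = (\<Union>S\<in>subst_tile \<sigma> T. stopped \<sigma> S)"
proof
  show "stopped \<sigma> T \<subseteq> (\<Union>S\<in>subst_tile \<sigma> T. stopped \<sigma> S)"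
  proof
    fix S assume S: "S \<in> stopped \<sigma> T"
    then have "(T, S) \<in> (large_child_rel \<sigma>)\<^sup>*" "S \<noteq> T"
      using assms by (auto simp: stopped_def)
    then obtain T' where "(T, T') \<in> large_child_rel \<sigma>" "(T', S) \<in> (large_child_rel \<sigma>)\<^sup>*"
      by (auto elim: converse_rtranclE)
    then show "S \<in> (\<Union>S\<in>subst_tile \<sigma> T. stopped \<sigma> S)"
      using S by (auto simp: stopped_def large_child_rel_def)
  qed
  show "(\<Union>S\<in>subst_tile \<sigma> T. stopped \<sigma> S) \<subseteq> stopped \<sigma> T"
    using assms by (auto simp: stopped_def large_child_rel_def intro: converse_rtrancl_into_rtrancl)
qed

text \<open>The loop invariant: one pass replaces some tiles by their children and does not change where
  their lines of descent stop.\<close>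

lemma stopped_subst_large:
  "(\<Union>T\<in>subst_large \<sigma> P. stopped \<sigma> T) = (\<Union>T\<in>P. stopped \<sigma> T)"
proof -
  have "(\<Union>T\<in>subst_large \<sigma> P. stopped \<sigma> T)
      = (\<Union>T\<in>P. if vol T > 1 then \<Union>S\<in>subst_tile \<sigma> T. stopped \<sigma> S else stopped \<sigma> T)"
    by (auto simp: subst_large_def not_less split: if_splits)
  also have "\<dots> = (\<Union>T\<in>P. stopped \<sigma> T)"
    by (intro SUP_cong) (auto simp: stopped_large)
  finally show ?thesis .
qed

section \<open>Normalized schemes\<close>

locale normalized_scheme =
  fixes \<sigma> :: "'a::euclidean_space scheme"
  assumes scheme: "substitution_scheme \<sigma>"
    and normalized: "normalized \<sigma>"
    and different: "geometrically_different \<sigma>"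
begin

lemma tile_prototile: "j < num_types \<sigma> \<Longrightarrow> tile (prototile \<sigma> j)"
  using scheme by (simp add: substitution_scheme_def)

lemma tile_scheme_tile: "scheme_tile \<sigma> T \<Longrightarrow> tile T"
  by (auto simp: scheme_tile_iff tile_prototile tile_copy)

lemma vol_copy_prototile:
  "j < num_types \<sigma> \<Longrightarrow> \<alpha> > 0 \<Longrightarrow> vol (copy v \<alpha> (prototile \<sigma> j)) = \<alpha> ^ DIM('a)"
  using normalized by (simp add: normalized_def vol_copy)

text \<open>Type, scale and position of a tile are determined by the tile: the type because prototiles are
  geometrically different, the scale by the volume, the position because a bounded set has no
  translational symmetry. Consequently a tile is substituted in only one way.\<close>

lemma copy_prototile_eqD:
  assumes eq: "copy v \<alpha> (prototile \<sigma> i) = copy w \<beta> (prototile \<sigma> j)"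
    and ij: "i < num_types \<sigma>" "j < num_types \<sigma>" and pos: "\<alpha> > 0" "\<beta> > 0"
  shows "i = j \<and> \<alpha> = \<beta> \<and> v = w"
proof -
  have "prototile \<sigma> i = copy (- (1 / \<alpha>) *\<^sub>R v) (1 / \<alpha>) (copy w \<beta> (prototile \<sigma> j))"
    using pos copy_inverse(1)[of \<alpha> v "prototile \<sigma> i"] eq by simp
  then have "tile_of_type_scale \<sigma> j (\<beta> / \<alpha>) (prototile \<sigma> i)"
    unfolding copy_copy using ij pos by (auto simp: tile_of_type_scale_def copy_fold)
  then have "i = j"
    using different ij by (auto simp: geometrically_different_def)
  have "\<alpha> ^ DIM('a) = \<beta> ^ DIM('a)"
    using eq vol_copy_prototile ij pos by metis
  then have "\<alpha> = \<beta>"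
    using pos by (simp add: power_eq_iff_eq_base)
  have "translate (v - w) (copy w \<beta> (prototile \<sigma> j)) = copy w \<beta> (prototile \<sigma> j)"
    using eq unfolding \<open>i = j\<close> \<open>\<alpha> = \<beta>\<close> by (simp add: translate_eq_copy copy_copy)
  moreover have "tile (copy w \<beta> (prototile \<sigma> j))"
    using tile_copy tile_prototile ij pos by blast
  ultimately have "v - w = 0"
    by (intro translate_fixes_bounded_imp_0[of "copy w \<beta> (prototile \<sigma> j)"]) (auto simp: tile_def)
  then show ?thesis
    using \<open>i = j\<close> \<open>\<alpha> = \<beta>\<close> by simp
qed

lemma subst_tile_copy_prototile:
  assumes "j < num_types \<sigma>" "\<alpha> > 0"
  shows "subst_tile \<sigma> (copy v \<alpha> (prototile \<sigma> j)) = copy v \<alpha> ` subst_rule \<sigma> j"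
proof
  show "subst_tile \<sigma> (copy v \<alpha> (prototile \<sigma> j)) \<subseteq> copy v \<alpha> ` subst_rule \<sigma> j"
  proof
    fix S assume "S \<in> subst_tile \<sigma> (copy v \<alpha> (prototile \<sigma> j))"
    then obtain i \<beta> w S0 where "i < num_types \<sigma>" "\<beta> > 0"
      "copy v \<alpha> (prototile \<sigma> j) = copy w \<beta> (prototile \<sigma> i)" "S0 \<in> subst_rule \<sigma> i" "S = copy w \<beta> S0"
      by (auto simp: subst_tile_def copy_fold)
    then show "S \<in> copy v \<alpha> ` subst_rule \<sigma> j"
      using copy_prototile_eqD[of v \<alpha> j w \<beta> i] assms by blast
  qed
  show "copy v \<alpha> ` subst_rule \<sigma> j \<subseteq> subst_tile \<sigma> (copy v \<alpha> (prototile \<sigma> j))"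
    using assms by (auto simp: subst_tile_def copy_fold)
qed

lemma subst_tile_tessellation:
  assumes "scheme_tile \<sigma> T"
  shows "tessellation (subst_tile \<sigma> T) T" "finite (subst_tile \<sigma> T)"
    "\<And>S. S \<in> subst_tile \<sigma> T \<Longrightarrow> scheme_tile \<sigma> S"
proof -
  obtain j \<alpha> v where T: "j < num_types \<sigma>" "\<alpha> > 0" "T = copy v \<alpha> (prototile \<sigma> j)"
    using assms by (auto simp: scheme_tile_iff)
  show "tessellation (subst_tile \<sigma> T) T" "finite (subst_tile \<sigma> T)"
    using scheme T by (auto simp: substitution_scheme_def subst_tile_copy_prototile tessellation_copy)
  fix S assume "S \<in> subst_tile \<sigma> T"
  then obtain S0 where "S0 \<in> subst_rule \<sigma> j" "S = copy v \<alpha> S0"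
    using T subst_tile_copy_prototile by auto
  moreover have "scheme_tile \<sigma> S0"
    using scheme T \<open>S0 \<in> subst_rule \<sigma> j\<close> unfolding substitution_scheme_def scheme_tile_def by blast
  ultimately show "scheme_tile \<sigma> S"
    using scheme_tile_copy T by blast
qed

text \<open>The scales in the substitution rule are less than 1 and finite in number, so one factor
  works for all of them. This uniform contraction makes the loop terminate.\<close>

lemma child_vol_bound:
  obtains c where "0 < c" "c < 1" "\<And>T S. S \<in> subst_tile \<sigma> T \<Longrightarrow> vol S \<le> c * vol T"
proof -
  \<comment> \<open>The element \<open>1/2\<close> makes the set nonempty and its maximum positive.\<close>
  define V where "V = insert (1/2) (vol ` (\<Union>i<num_types \<sigma>. subst_rule \<sigma> i))"
  have fin: "finite V" using scheme by (auto simp: V_def substitution_scheme_def)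
  have "x < 1" if x: "x \<in> V" for x
  proof (cases "x = 1/2")
    case False
    then obtain i S where S: "i < num_types \<sigma>" "S \<in> subst_rule \<sigma> i" "x = vol S"
      using x by (auto simp: V_def)
    then obtain j \<alpha> where "\<alpha> < 1" "tile_of_type_scale \<sigma> j \<alpha> S"
      using scheme unfolding substitution_scheme_def by blast
    then obtain v where "j < num_types \<sigma>" "\<alpha> < 1" "\<alpha> > 0" "S = copy v \<alpha> (prototile \<sigma> j)"
      by (auto simp: tile_of_type_scale_def copy_fold)
    then show ?thesis
      using S vol_copy_prototile power_less_one_iff[of \<alpha> "DIM('a)"] by simp
  qed simp
  then have "Max V < 1" using fin by (subst Max_less_iff) (auto simp: V_def)
  moreover have "0 < Max V"
    using Max_ge[OF fin, of "1/2"] by (simp add: V_def)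
  moreover have "vol S \<le> Max V * vol T" if child: "S \<in> subst_tile \<sigma> T" for S T
  proof -
    obtain j \<alpha> v S0 where *: "j < num_types \<sigma>" "\<alpha> > 0" "T = copy v \<alpha> (prototile \<sigma> j)"
        "S0 \<in> subst_rule \<sigma> j" "S = copy v \<alpha> S0"
      using child by (auto simp: subst_tile_def copy_fold)
    then have "vol S0 \<le> Max V" using fin by (intro Max_ge) (auto simp: V_def)
    then show ?thesis
      using * normalized by (simp add: normalized_def vol_copy mult.commute)
  qed
  ultimately show ?thesis using that by blast
qed

lemma scheme_tile_if_child: "S \<in> subst_tile \<sigma> T \<Longrightarrow> scheme_tile \<sigma> T"
  by (auto simp: subst_tile_def scheme_tile_iff copy_fold)

lemma child_vol_less:
  assumes "S \<in> subst_tile \<sigma> T" shows "vol S < vol T"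
proof -
  obtain c where "0 < c" "c < 1" "vol S \<le> c * vol T"
    using child_vol_bound assms by metis
  moreover have "vol T > 0"
    using tile_scheme_tile[OF scheme_tile_if_child[OF assms]] by (simp add: tile_def)
  ultimately show ?thesis
    by (smt (verit) mult_less_cancel_right2)
qed

lemma descendant_props:
  assumes "(T, S) \<in> (child_rel \<sigma>)\<^sup>*" "scheme_tile \<sigma> T"
  shows "scheme_tile \<sigma> S \<and> S \<subseteq> T"
  using assms(1)
proof induction
  case (step S S')
  then have "S' \<in> subst_tile \<sigma> S" "scheme_tile \<sigma> S" by (auto simp: child_rel_def)
  then have "S' \<subseteq> S" "scheme_tile \<sigma> S'"
    using subst_tile_tessellation[of S] by (auto simp: tessellation_def)
  then show ?case using step by blast
qed (simp add: assms)

text \<open>Volumes decrease strictly along a line of descent, so every proper ancestor of a tile of volume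
  at least 1 is larger than 1 and is substituted by the loop.\<close>

lemma descendant_imp_large_descendant:
  assumes "(T, S) \<in> (child_rel \<sigma>)\<^sup>*" "vol S \<ge> 1"
  shows "(T, S) \<in> (large_child_rel \<sigma>)\<^sup>*"
  using assms
proof induction
  case (step S S')
  then have "vol S > 1" "S' \<in> subst_tile \<sigma> S"
    using child_vol_less[of S' S] by (auto simp: child_rel_def)
  then show ?case
    using step by (auto simp: large_child_rel_def intro: rtrancl_into_rtrancl)
qed simp

lemma subst_large_tessellation:
  assumes "tessellation P U" "finite P" "\<forall>T\<in>P. scheme_tile \<sigma> T"
  shows "tessellation (subst_large \<sigma> P) U" "finite (subst_large \<sigma> P)"
    "\<forall>T\<in>subst_large \<sigma> P. scheme_tile \<sigma> T"
proof -
  have eq: "subst_large \<sigma> P = (\<Union>T\<in>P. if vol T > 1 then subst_tile \<sigma> T else {T})"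
    by (auto simp: subst_large_def not_less split: if_splits)
  show "tessellation (subst_large \<sigma> P) U"
    unfolding eq using assms
    by (intro tessellation_refine) (auto simp: subst_tile_tessellation tessellation_singleton tile_scheme_tile)
  show "finite (subst_large \<sigma> P)"
    using assms by (auto simp: eq subst_tile_tessellation)
  show "\<forall>T\<in>subst_large \<sigma> P. scheme_tile \<sigma> T"
    using assms by (auto simp: eq subst_tile_tessellation split: if_splits)
qed

text \<open>Termination holds because each pass shrinks the large tiles by a uniform factor \<open>c < 1\<close>. The
  rank of a finite patch is the least number of such contractions that bring all its volumes down to 1;
  every pass lowers it.\<close>

lemma while_subst_large:
  assumes "tessellation P U" "finite P" "\<forall>T\<in>P. scheme_tile \<sigma> T"
  defines "Q \<equiv> while (\<lambda>P. \<exists>S\<in>P. vol S > 1) (subst_large \<sigma>) P"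
  shows "Q = (\<Union>T\<in>P. stopped \<sigma> T) \<and> tessellation Q U \<and> finite Q"
proof -
  obtain c where c: "0 < c" "c < 1" and child: "\<And>T S. S \<in> subst_tile \<sigma> T \<Longrightarrow> vol S \<le> c * vol T"
    using child_vol_bound by metis
  define rank where "rank P = (LEAST n. \<forall>S\<in>P. c ^ n * vol S \<le> 1)" for P :: "'a set set"
  have rank_bound: "\<forall>S\<in>R. c ^ rank R * vol S \<le> 1" if "finite R" for R
  proof -
    have "\<exists>n. \<forall>S\<in>R. c ^ n * vol S \<le> 1"
    proof -
      have small: "\<forall>\<^sub>F n in sequentially. c ^ n * vol S \<le> 1" for S :: "'a set"
      proof -
        have "(\<lambda>n. c ^ n * vol S) \<longlonglongrightarrow> 0"
          using c by (intro tendsto_mult_left_zero LIMSEQ_realpow_zero) auto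
        then have "\<forall>\<^sub>F n in sequentially. c ^ n * vol S < 1"
          by (rule order_tendstoD) simp
        then show ?thesis by eventually_elim simp
      qed
      then have "\<forall>\<^sub>F n in sequentially. \<forall>S\<in>R. c ^ n * vol S \<le> 1"
        by (intro eventually_ball_finite ballI that small)
      then show ?thesis
        using eventually_happens'[OF sequentially_bot] by blast
    qed
    then show ?thesis unfolding rank_def by (rule LeastI_ex)
  qed
  have rank_less: "rank (subst_large \<sigma> R) < rank R" if R: "finite R" "\<exists>S\<in>R. vol S > 1" for R
  proof -
    have "rank R \<noteq> 0"
    proof
      assume "rank R = 0"
      then show False using rank_bound[OF R(1)] R(2) by auto
    qed
    then obtain n where n: "rank R = Suc n" by (cases "rank R") auto
    have "c ^ n * vol S \<le> 1" if S: "S \<in> subst_large \<sigma> R" for S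
    proof (cases "S \<in> R \<and> vol S \<le> 1")
      case True
      then have "c ^ n * vol S \<le> 1 * 1"
        using c by (intro mult_mono power_le_one) auto
      then show ?thesis by simp
    next
      case False
      then obtain T where T: "T \<in> R" "S \<in> subst_tile \<sigma> T"
        using S by (auto simp: subst_large_def)
      have "c ^ n * vol S \<le> c ^ n * (c * vol T)"
        using child[OF T(2)] c by (intro mult_left_mono) auto
      also have "\<dots> = c ^ rank R * vol T" by (simp add: n)
      also have "\<dots> \<le> 1" using rank_bound[OF R(1)] T by blast
      finally show ?thesis .
    qed
    then have "rank (subst_large \<sigma> R) \<le> n"
      unfolding rank_def by (intro Least_le) auto
    then show ?thesis using n by simp
  qed
  let ?I = "\<lambda>R. (\<Union>T\<in>R. stopped \<sigma> T) = (\<Union>T\<in>P. stopped \<sigma> T) \<and> tessellation R U \<and> finite R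
    \<and> (\<forall>T\<in>R. scheme_tile \<sigma> T)"
  show ?thesis
    unfolding Q_def
  proof (rule while_rule[where P = ?I and r = "inv_image less_than rank"
        and Q = "\<lambda>R. R = (\<Union>T\<in>P. stopped \<sigma> T) \<and> tessellation R U \<and> finite R"])
    show "?I P" using assms(1-3) by (intro conjI refl)
    show "?I (subst_large \<sigma> R)" if "?I R" for R
    proof -
      have "(\<Union>T\<in>R. stopped \<sigma> T) = (\<Union>T\<in>P. stopped \<sigma> T)" "tessellation R U" "finite R"
        "\<forall>T\<in>R. scheme_tile \<sigma> T"
        using that by - (elim conjE, assumption)+
      then show ?thesis
        unfolding stopped_subst_large by (intro conjI subst_large_tessellation)
    qed
    show "(subst_large \<sigma> R, R) \<in> inv_image less_than rank" if "?I R" "\<exists>S\<in>R. vol S > 1" for R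
    proof -
      have "finite R" using that(1) by (elim conjE)
      then show ?thesis using rank_less[of R] that(2) by simp
    qed
    show "R = (\<Union>T\<in>P. stopped \<sigma> T) \<and> tessellation R U \<and> finite R"
      if "?I R" "\<not> (\<exists>S\<in>R. vol S > 1)" for R
    proof -
      have "(\<Union>T\<in>R. stopped \<sigma> T) = R"
        using that(2) by (simp add: stopped_small not_less)
      moreover have "(\<Union>T\<in>R. stopped \<sigma> T) = (\<Union>T\<in>P. stopped \<sigma> T)" "tessellation R U" "finite R"
        using that(1) by - (elim conjE, assumption)+
      ultimately show ?thesis by (intro conjI) (rule trans[OF sym])
    qed
    show "wf (inv_image less_than rank)" by simp
  qed
qed

lemma flow_tile_stopped:
  assumes "scheme_tile \<sigma> T"
  shows "flow_tile \<sigma> t T = stopped \<sigma> (rescale (exp t) T)"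
    and "tessellation (flow_tile \<sigma> t T) (rescale (exp t) T)"
    and "finite (flow_tile \<sigma> t T)"
proof -
  let ?X = "rescale (exp t) T"
  have X: "scheme_tile \<sigma> ?X"
    using scheme_tile_copy[OF assms, of "exp t" 0] by (simp add: rescale_eq_copy)
  have "flow_tile \<sigma> t T = (\<Union>Y\<in>{?X}. stopped \<sigma> Y)
      \<and> tessellation (flow_tile \<sigma> t T) ?X \<and> finite (flow_tile \<sigma> t T)"
    unfolding flow_tile_def
    by (rule while_subst_large) (use X in \<open>simp_all add: tessellation_singleton tile_scheme_tile\<close>)
  moreover have "(\<Union>Y\<in>{?X}. stopped \<sigma> Y) = stopped \<sigma> ?X" by simp
  ultimately show "flow_tile \<sigma> t T = stopped \<sigma> ?X" "tessellation (flow_tile \<sigma> t T) ?X"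
    "finite (flow_tile \<sigma> t T)"
    by (metis (no_types))+
qed

lemma flow_tile_scheme_tile:
  assumes "scheme_tile \<sigma> T" "S \<in> flow_tile \<sigma> t T"
  shows "scheme_tile \<sigma> S" "vol S \<le> 1" "(rescale (exp t) T, S) \<in> (child_rel \<sigma>)\<^sup>*"
proof -
  show "vol S \<le> 1" and desc: "(rescale (exp t) T, S) \<in> (child_rel \<sigma>)\<^sup>*"
    using assms(2) large_descendant_imp_descendant
    unfolding flow_tile_stopped(1)[OF assms(1)] stopped_def by auto
  then show "scheme_tile \<sigma> S"
    using descendant_props scheme_tile_copy[OF assms(1), of "exp t" 0]
    by (simp add: rescale_eq_copy)
qed

lemma flow_tile_0: "scheme_tile \<sigma> T \<Longrightarrow> vol T \<le> 1 \<Longrightarrow> flow_tile \<sigma> 0 T = {T}"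
  by (simp add: flow_tile_stopped stopped_small rescale_def)

lemma stopped_translate: "stopped \<sigma> (translate v T) = translate v ` stopped \<sigma> T"
proof -
  have *: "translate v S \<in> stopped \<sigma> (translate v T)" if "S \<in> stopped \<sigma> T" for v S T
    using that large_descendant_copy[of T S \<sigma> 1 v]
    by (simp add: stopped_def translate_eq_copy vol_copy)
  have inv: "translate (- v) (translate v S) = S" "translate v (translate (- v) S) = S" for S :: "'a set"
    by (simp_all add: translate_def image_image)
  show ?thesis
    using *[of _ T v] *[of _ "translate v T" "- v"] inv by (auto simp: image_iff) metis
qed

lemma flow_tile_translate:
  assumes "scheme_tile \<sigma> T"
  shows "flow_tile \<sigma> t (translate v T) = translate (exp t *\<^sub>R v) ` flow_tile \<sigma> t T"
proof -
  have "rescale (exp t) (translate v T) = translate (exp t *\<^sub>R v) (rescale (exp t) T)"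
    by (simp add: rescale_def translate_def image_image scaleR_add_right)
  then show ?thesis
    using scheme_tile_copy[OF assms, of 1 v] assms
    by (simp add: flow_tile_stopped stopped_translate flip: translate_eq_copy)
qed

text \<open>Follow a line of descent from \<open>\<alpha>X\<close> down to \<open>S\<close> and divide it by \<open>\<alpha>\<close>. The first tile of
  volume at most 1 on the contracted line is where the descent from \<open>X\<close> stops, and the rest of the
  line leads from its inflation to \<open>S\<close>.\<close>

lemma stopped_factor:
  assumes "(rescale \<alpha> X, S) \<in> (large_child_rel \<sigma>)\<^sup>*" "vol S \<le> 1" "\<alpha> \<ge> 1"
  shows "\<exists>T \<in> stopped \<sigma> X. (rescale \<alpha> T, S) \<in> (large_child_rel \<sigma>)\<^sup>*"
proof -
  have "Z = rescale \<alpha> X \<Longrightarrow> \<exists>T \<in> stopped \<sigma> X. (rescale \<alpha> T, S) \<in> (large_child_rel \<sigma>)\<^sup>*"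
    if "(Z, S) \<in> (large_child_rel \<sigma>)\<^sup>*" for Z X
    using that
  proof (induction arbitrary: X rule: converse_rtrancl_induct)
    case base
    have "1 * vol X \<le> vol (rescale \<alpha> X)"
      unfolding rescale_eq_copy vol_copy using assms(3) by (intro mult_right_mono) auto
    then have "vol X \<le> 1" using base assms(2) by simp
    then show ?case using base by (auto simp: stopped_small)
  next
    case (step Y Z)
    show ?case
    proof (cases "vol X \<le> 1")
      case True
      then show ?thesis
        using step by (auto simp: stopped_small intro: converse_rtrancl_into_rtrancl)
    next
      case False
      have "Z \<in> subst_tile \<sigma> (copy 0 \<alpha> X)"
        using step by (simp add: large_child_rel_def rescale_eq_copy)
      then obtain X' where X': "X' \<in> subst_tile \<sigma> X" "Z = rescale \<alpha> X'"
        using subst_tile_copy[of \<alpha> \<sigma> 0 X] assms(3) by (auto simp: rescale_eq_copy)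
      then show ?thesis
        using step.IH[OF X'(2)] stopped_large[of X \<sigma>] False by auto
    qed
  qed
  then show ?thesis using assms(1) by blast
qed

text \<open>The semi-flow property: a descent that stops at time \<open>t\<close> and resumes after the inflation by
  \<open>e\<^sup>s\<close> arrives at the same tiles as an uninterrupted one.\<close>

lemma flow_flow_tile:
  assumes T: "scheme_tile \<sigma> T" and "s \<ge> 0"
  shows "flow \<sigma> s (flow_tile \<sigma> t T) = flow_tile \<sigma> (s + t) T"
proof -
  let ?X = "rescale (exp t) T"
  have X: "rescale (exp (s + t)) T = rescale (exp s) ?X"
    by (simp add: rescale_def image_image exp_add)
  have "flow \<sigma> s (flow_tile \<sigma> t T) = (\<Union>S\<in>stopped \<sigma> ?X. stopped \<sigma> (rescale (exp s) S))"
    unfolding flow_def using flow_tile_scheme_tile(1)[OF T] T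
    by (simp add: flow_tile_stopped(1))
  also have "\<dots> = stopped \<sigma> (rescale (exp s) ?X)"
  proof
    show "(\<Union>S\<in>stopped \<sigma> ?X. stopped \<sigma> (rescale (exp s) S)) \<subseteq> stopped \<sigma> (rescale (exp s) ?X)"
      using large_descendant_copy[of ?X _ \<sigma> "exp s" 0] \<open>s \<ge> 0\<close>
      by (auto simp: stopped_def rescale_eq_copy intro: rtrancl_trans)
    show "stopped \<sigma> (rescale (exp s) ?X) \<subseteq> (\<Union>S\<in>stopped \<sigma> ?X. stopped \<sigma> (rescale (exp s) S))"
      using stopped_factor[of "exp s" ?X] \<open>s \<ge> 0\<close> by (auto simp: stopped_def)
  qed
  finally show ?thesis
    by (simp add: flow_tile_stopped(1)[OF T] X)
qed

lemma flow_mono: "P \<subseteq> Q \<Longrightarrow> flow \<sigma> s P \<subseteq> flow \<sigma> s Q"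
  by (auto simp: flow_def)

section \<open>A tile inside a tile of the same type\<close>

lemma scheme_tile_diameter:
  obtains M where "M > 0"
    "\<And>S x y. scheme_tile \<sigma> S \<Longrightarrow> vol S \<le> 1 \<Longrightarrow> x \<in> S \<Longrightarrow> y \<in> S \<Longrightarrow> dist x y \<le> M"
proof -
  have "bounded (\<Union>j<num_types \<sigma>. prototile \<sigma> j)"
    using tile_prototile by (auto simp: tile_def)
  then obtain B where B: "B > 0" "\<And>x j. j < num_types \<sigma> \<Longrightarrow> x \<in> prototile \<sigma> j \<Longrightarrow> norm x \<le> B"
    unfolding bounded_pos by blast
  have "dist x y \<le> 2 * B" if S: "scheme_tile \<sigma> S" "vol S \<le> 1" and "x \<in> S" "y \<in> S" for S x y
  proof -
    obtain j \<alpha> v where j: "j < num_types \<sigma>" "\<alpha> > 0" "S = copy v \<alpha> (prototile \<sigma> j)"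
      using S by (auto simp: scheme_tile_iff)
    then have "\<alpha> \<le> 1"
      using S vol_copy_prototile[of j \<alpha> v] power_le_one_iff[of \<alpha> "DIM('a)"] by simp
    obtain x' y' where xy: "x' \<in> prototile \<sigma> j" "y' \<in> prototile \<sigma> j"
        "x = v + \<alpha> *\<^sub>R x'" "y = v + \<alpha> *\<^sub>R y'"
      using \<open>x \<in> S\<close> \<open>y \<in> S\<close> j by (auto simp: copy_eq_image)
    have "dist x y = \<alpha> * dist x' y'"
      using xy j by (simp add: dist_norm flip: scaleR_diff_right)
    also have "\<dots> \<le> 1 * (norm x' + norm y')"
      using \<open>\<alpha> \<le> 1\<close> j by (intro mult_mono) (auto simp: dist_norm norm_triangle_ineq4)
    also have "\<dots> \<le> 2 * B"
      using B(2)[OF j(1) xy(1)] B(2)[OF j(1) xy(2)] by simp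
    finally show ?thesis .
  qed
  then show ?thesis using that[of "2 * B"] B by simp
qed

lemma scheme_tile_scale_le_1:
  assumes "scheme_tile \<sigma> S" "vol S \<le> 1"
  shows "\<exists>j \<alpha>. \<alpha> \<le> 1 \<and> tile_of_type_scale \<sigma> j \<alpha> S"
proof -
  obtain j \<alpha> v where j: "j < num_types \<sigma>" "\<alpha> > 0" "S = copy v \<alpha> (prototile \<sigma> j)"
    using assms by (auto simp: scheme_tile_iff)
  then have "\<alpha> \<le> 1"
    using assms vol_copy_prototile[of j \<alpha> v] power_le_one_iff[of \<alpha> "DIM('a)"] by simp
  then show ?thesis using j by (auto simp: tile_of_type_scale_def copy_fold)
qed

text \<open>A descendant of type \<open>i\<close> that is compactly contained in the interior of its ancestor of type
  \<open>i\<close> is the image of the ancestor under a contraction whose fixed point is interior. The translation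
  by \<open>p\<close> moves this fixed point to the origin.\<close>

lemma self_similar_descendant:
  assumes origin: "origin_interior \<sigma>" and irreducible: "irreducible_scheme \<sigma>" and i: "i < num_types \<sigma>"
  obtains p \<gamma> where "0 < \<gamma>" "\<gamma> < 1" "0 \<in> interior (translate p (prototile \<sigma> i))"
    "(translate p (prototile \<sigma> i), rescale \<gamma> (translate p (prototile \<sigma> i))) \<in> (child_rel \<sigma>)\<^sup>*"
proof -
  let ?T = "prototile \<sigma> i"
  have T: "scheme_tile \<sigma> ?T" using i by (rule prototile_scheme_tile)
  obtain r where r: "r > 0" "ball 0 r \<subseteq> ?T"
    using origin i by (auto simp: origin_interior_def mem_interior)
  obtain M where M: "M > 0"
    "\<And>S x y. scheme_tile \<sigma> S \<Longrightarrow> vol S \<le> 1 \<Longrightarrow> x \<in> S \<Longrightarrow> y \<in> S \<Longrightarrow> dist x y \<le> M"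
    using scheme_tile_diameter by metis
  \<comment> \<open>After this inflation a tile of diameter at most \<open>M\<close> that contains the origin is
    interior to the support.\<close>
  obtain t where t: "exp t * r > M" "exp t > 1"
  proof -
    have "exp (ln (M / r + 2)) * r > M" "exp (ln (M / r + 2)) > 1"
      using M r by (simp_all add: field_simps add_pos_pos)
    then show ?thesis using that by blast
  qed
  let ?X = "rescale (exp t) ?T"
  have X: "scheme_tile \<sigma> ?X"
    using scheme_tile_copy[OF T, of "exp t" 0] by (simp add: rescale_eq_copy)
  have ball: "ball 0 (exp t * r) \<subseteq> ?X"
  proof
    fix x :: 'a assume "x \<in> ball 0 (exp t * r)"
    then have "(1 / exp t) *\<^sub>R x \<in> ?T"
      using r by (auto simp: field_simps subset_iff)
    then show "x \<in> ?X" unfolding rescale_def by (rule rev_image_eqI) simp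
  qed
  then have "0 \<in> ?X" using t M by force
  then obtain S where S: "S \<in> flow_tile \<sigma> t ?T" "0 \<in> S"
    using flow_tile_stopped(2)[OF T, of t] by (auto simp: tessellation_def)
  have S': "scheme_tile \<sigma> S" "vol S \<le> 1" "(?X, S) \<in> (child_rel \<sigma>)\<^sup>*"
    using flow_tile_scheme_tile[OF T S(1)] by auto
  have S_sub: "S \<subseteq> cball 0 M"
    using M(2)[OF S'(1,2) S(2)] by auto
  \<comment> \<open>Irreducibility, applied to the type of \<open>S\<close>, gives a descendant of type \<open>i\<close>.\<close>
  have "\<exists>w \<beta>. \<beta> > 0 \<and> (S, copy w \<beta> ?T) \<in> (child_rel \<sigma>)\<^sup>*"
  proof -
    obtain j \<alpha> v where j: "j < num_types \<sigma>" "\<alpha> > 0" "S = copy v \<alpha> (prototile \<sigma> j)"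
      using S' by (auto simp: scheme_tile_iff)
    then obtain u Y \<beta> where Y: "Y \<in> flow_tile \<sigma> u (prototile \<sigma> j)" "tile_of_type_scale \<sigma> i \<beta> Y"
      using irreducible i unfolding irreducible_scheme_def by blast
    then obtain w where w: "\<beta> > 0" "Y = copy w \<beta> ?T" by (auto simp: tile_of_type_scale_def copy_fold)
    have "(copy 0 (exp u) (prototile \<sigma> j), Y) \<in> (child_rel \<sigma>)\<^sup>*"
      using flow_tile_scheme_tile[OF prototile_scheme_tile Y(1)] j by (simp add: rescale_eq_copy)
    then have "(copy v (\<alpha> * exp (- u)) (copy 0 (exp u) (prototile \<sigma> j)), copy v (\<alpha> * exp (- u)) Y)
        \<in> (child_rel \<sigma>)\<^sup>*"
      using j by (intro descendant_copy) auto
    moreover have "\<alpha> * exp (- u) * exp u = \<alpha>" by (simp add: exp_minus)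
    ultimately have "(S, copy (v + (\<alpha> * exp (- u)) *\<^sub>R w) (\<alpha> * exp (- u) * \<beta>) ?T) \<in> (child_rel \<sigma>)\<^sup>*"
      using j w by (simp add: copy_copy)
    moreover have "\<alpha> * exp (- u) * \<beta> > 0" using j w by simp
    ultimately show ?thesis by blast
  qed
  then obtain w \<beta> where \<beta>: "\<beta> > 0" "(S, copy w \<beta> ?T) \<in> (child_rel \<sigma>)\<^sup>*" by blast
  define \<gamma> where "\<gamma> = \<beta> / exp t"
  have Z: "copy w \<beta> ?T = copy w \<gamma> ?X"
    by (simp add: rescale_eq_copy copy_copy \<gamma>_def)
  have Z_sub: "copy w \<gamma> ?X \<subseteq> cball 0 M"
    using descendant_props[OF \<beta>(2) S'(1)] S_sub Z by auto
  have desc: "(?X, copy w \<gamma> ?X) \<in> (child_rel \<sigma>)\<^sup>*"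
    using S'(3) \<beta>(2) Z by (metis rtrancl_trans)
  have "\<gamma> > 0" using \<beta> by (simp add: \<gamma>_def)
  have "\<gamma> < 1"
  proof -
    have "\<beta> ^ DIM('a) = vol (copy w \<beta> ?T)"
      using i \<beta> by (simp add: vol_copy_prototile)
    also have "\<dots> \<le> vol S"
    proof (rule measure_mono_fmeasurable)
      show "copy w \<beta> ?T \<subseteq> S" "copy w \<beta> ?T \<in> sets lebesgue" "S \<in> lmeasurable"
        using descendant_props[OF \<beta>(2) S'(1)] tile_scheme_tile S'(1)
        by (auto simp: tile_def bounded_set_imp_lmeasurable)
    qed
    also have "\<dots> \<le> 1" by (rule S')
    finally have "\<beta> \<le> 1" using \<beta> power_le_one_iff[of \<beta> "DIM('a)"] by simp
    then have "\<beta> < exp t" using t(2) by linarith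
    then show ?thesis by (simp add: \<gamma>_def)
  qed
  have inX: "cball 0 M \<subseteq> interior ?X"
  proof -
    have "cball 0 M \<subseteq> ball (0::'a) (exp t * r)" using t by auto
    also have "\<dots> \<subseteq> interior ?X" using ball by (intro interior_maximal) auto
    finally show ?thesis .
  qed
  obtain q where q: "q \<in> cball 0 M" "w + \<gamma> *\<^sub>R q = q"
  proof (rule brouwer_ball[OF M(1)])
    show "continuous_on (cball 0 M) (\<lambda>x. w + \<gamma> *\<^sub>R x)" by (intro continuous_intros)
    have "w + \<gamma> *\<^sub>R x \<in> cball 0 M" if "x \<in> cball 0 M" for x
    proof -
      have "x \<in> ?X" using that inX interior_subset by blast
      then show ?thesis using Z_sub by (auto simp: copy_eq_image)
    qed
    then show "(\<lambda>x. w + \<gamma> *\<^sub>R x) \<in> cball 0 M \<rightarrow> cball 0 M" by auto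
  qed
  define p where "p = - (exp (- t) *\<^sub>R q)"
  have p: "copy p (exp (- t)) ?X = translate p ?T"
    by (simp add: rescale_eq_copy translate_eq_copy copy_copy flip: exp_add)
  have "(translate p ?T, copy p (exp (- t)) (copy w \<gamma> ?X)) \<in> (child_rel \<sigma>)\<^sup>*"
    using descendant_copy[OF desc, of "exp (- t)" p] by (simp add: p)
  moreover have "copy p (exp (- t)) (copy w \<gamma> ?X) = rescale \<gamma> (translate p ?T)"
  proof -
    have w: "w = q - \<gamma> *\<^sub>R q" using q(2) by (metis add_diff_cancel_right')
    have "p + exp (- t) *\<^sub>R w = \<gamma> *\<^sub>R p"
      unfolding w p_def by (simp add: algebra_simps)
    moreover have "exp (- t) * (\<gamma> * exp t) = \<gamma>" by (simp add: exp_minus)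
    ultimately show ?thesis
      by (simp only: rescale_eq_copy translate_eq_copy copy_copy scaleR_zero_right add_0_right
          add_0_left mult_1_right)
  qed
  moreover have "0 \<in> interior (translate p ?T)"
  proof -
    have "q \<in> interior ?X" using q inX by blast
    then have "p + exp (- t) *\<^sub>R q \<in> interior (copy p (exp (- t)) ?X)"
      by (simp add: interior_copy) (simp add: copy_eq_image)
    then show ?thesis by (simp only: p) (simp add: p_def)
  qed
  ultimately show ?thesis
    using that \<open>\<gamma> > 0\<close> \<open>\<gamma> < 1\<close> by metis
qed

section \<open>The fixed tiling\<close>

text \<open>Translated back, \<open>P\<close> is a sub-patch of \<open>G\<close>, so the constant sequence with this sub-patch
  converges to \<open>P\<close>.\<close>

lemma limit_of_generated_translated:
  assumes "patch P" "P \<subseteq> translate v ` G" "G \<in> generating_patches \<sigma>"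
  shows "limit_of_generated \<sigma> P"
proof -
  let ?Q = "translate (- v) ` P"
  have inv: "translate (- v) (translate v S) = S" "translate v (translate (- v) S) = S" for S :: "'a set"
    by (simp_all add: translate_def image_image)
  obtain U where "tessellation P U" "bounded U"
    using assms(1) by (auto simp: patch_def)
  then have "tessellation ?Q (translate (- v) U)" "bounded (translate (- v) U)"
    using tessellation_copy[of P U 1 "- v"] bounded_translation[of U "- v"]
    by (simp_all add: translate_def flip: translate_eq_copy)
  then have "patch ?Q" by (auto simp: patch_def)
  moreover have "?Q \<subseteq> G" using assms(2) by (auto simp: inv)
  ultimately have "sub_patch ?Q G" by (simp add: sub_patch_def)
  moreover have "translate v ` ?Q = P" by (simp add: image_image inv)
  moreover have "set_dist A A = 0" for A :: "'a set"
  proof -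
    have "{r. r > 0 \<and> A \<inter> ball 0 (1 / r) \<subseteq> nbhd r A} \<union> {1} = {0<..}"
      by (auto simp: nbhd_def)
    then show ?thesis by (simp add: set_dist_def)
  qed
  ultimately show ?thesis
    unfolding limit_of_generated_def using assms(3)
    by (intro exI[of _ "\<lambda>_. ?Q"] exI[of _ "\<lambda>_. v"]) auto
qed

lemma inflated_tile_absorbs:
  assumes "0 \<in> interior T" "bounded U" "s > 0"
  shows "\<exists>k. U \<subseteq> rescale (exp (real k * s)) T"
proof -
  obtain r where r: "r > 0" "ball 0 r \<subseteq> T" using assms(1) by (auto simp: mem_interior)
  obtain B where B: "B > 0" "\<And>x. x \<in> U \<Longrightarrow> norm x \<le> B"
    using assms(2) by (auto simp: bounded_pos)
  obtain k where k: "B / (r * s) < real k" using reals_Archimedean2 by blast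
  have "B < r * (real k * s)" using k r assms(3) by (simp add: field_simps)
  also have "\<dots> < r * exp (real k * s)"
    using r exp_ge_add_one_self[of "real k * s"] by (intro mult_strict_left_mono) linarith+
  finally have k': "B < r * exp (real k * s)" .
  have "x \<in> rescale (exp (real k * s)) T" if "x \<in> U" for x
  proof -
    have "norm x < r * exp (real k * s)" using B(2)[OF that] k' by simp
    then have "(1 / exp (real k * s)) *\<^sub>R x \<in> T"
      using r(2) by (auto simp: field_simps subset_iff)
    then show ?thesis unfolding rescale_def by (rule rev_image_eqI) simp
  qed
  then show ?thesis by blast
qed

end

theorem theorem4p7:
  fixes \<sigma> :: "'a::euclidean_space scheme"
  assumes "substitution_scheme \<sigma>"
    and "normalized \<sigma>"
    and "geometrically_different \<sigma>"
    and "origin_interior \<sigma>"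
    and "irreducible_scheme \<sigma>"
  shows "\<exists>s>0. \<exists>\<S>\<in>tiling_space \<sigma>. flow \<sigma> s \<S> = \<S>"
proof -
  interpret normalized_scheme \<sigma> using assms by unfold_locales
  have n: "0 < num_types \<sigma>" using assms(1) by (simp only: substitution_scheme_def Suc_le_eq One_nat_def)
  obtain p \<gamma> where \<gamma>: "0 < \<gamma>" "\<gamma> < 1"
    and int: "0 \<in> interior (translate p (prototile \<sigma> 0))"
    and desc: "(translate p (prototile \<sigma> 0), rescale \<gamma> (translate p (prototile \<sigma> 0))) \<in> (child_rel \<sigma>)\<^sup>*"
    using self_similar_descendant[OF assms(4,5) n] by metis
  define T where "T = translate p (prototile \<sigma> 0)"
  define s where "s = - ln \<gamma>"
  have s: "s > 0" "exp s * \<gamma> = 1" using \<gamma> by (simp_all add: s_def exp_minus)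
  have T: "scheme_tile \<sigma> T"
    using scheme_tile_copy[OF prototile_scheme_tile[OF n], of 1 p] by (simp add: T_def translate_eq_copy)
  have vT: "vol T = 1"
    using vol_copy_prototile[OF n, of 1 p] by (simp add: T_def translate_eq_copy)
  have "(rescale (exp s) T, rescale (exp s) (rescale \<gamma> T)) \<in> (child_rel \<sigma>)\<^sup>*"
    using descendant_copy[OF desc, of "exp s" 0] by (simp add: rescale_eq_copy T_def)
  moreover have "rescale (exp s) (rescale \<gamma> T) = T"
    using s by (simp add: rescale_eq_copy copy_copy copy_0_1)
  ultimately have T_in: "T \<in> flow_tile \<sigma> s T"
    using descendant_imp_large_descendant vT by (simp add: flow_tile_stopped(1)[OF T] stopped_def)
  define F where "F k = flow_tile \<sigma> (real k * s) T" for k :: nat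
  have F_tess: "tessellation (F k) (rescale (exp (real k * s)) T)" "finite (F k)" for k
    using flow_tile_stopped[OF T] by (auto simp: F_def)
  have F_Suc: "flow \<sigma> s (F k) = F (Suc k)" for k
    using flow_flow_tile[OF T, of s "real k * s"] s by (simp add: F_def algebra_simps)
  have F_step: "F k \<subseteq> F (Suc k)" for k
  proof (induction k)
    case 0
    show ?case using T_in T vT by (simp add: F_def flow_tile_0)
  next
    case (Suc k)
    then show ?case using flow_mono[OF Suc, of s] by (simp only: F_Suc)
  qed
  then have F_mono: "F k \<subseteq> F m" if "k \<le> m" for k m
    using that by (rule lift_Suc_mono_le)
  define \<S> where "\<S> = (\<Union>k. F k)"
  have fixed: "flow \<sigma> s \<S> = \<S>"
  proof -
    have "flow \<sigma> s \<S> = (\<Union>k. F (Suc k))"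
      by (simp add: \<S>_def flow_def flip: F_Suc)
    also have "\<dots> = \<S>" using F_step by (auto simp: \<S>_def)
    finally show ?thesis .
  qed
  have tiles: "scheme_tile \<sigma> S" "vol S \<le> 1" if "S \<in> \<S>" for S
    using that flow_tile_scheme_tile[OF T] by (auto simp: \<S>_def F_def)
  have disj: "interior S \<inter> interior S' = {}" if "S \<in> \<S>" "S' \<in> \<S>" "S \<noteq> S'" for S S'
  proof -
    obtain k m where "S \<in> F k" "S' \<in> F m" using \<open>S \<in> \<S>\<close> \<open>S' \<in> \<S>\<close> by (auto simp: \<S>_def)
    then have "S \<in> F (max k m)" "S' \<in> F (max k m)"
      using F_mono[of k "max k m"] F_mono[of m "max k m"] by auto
    then show ?thesis
      using F_tess(1)[of "max k m"] \<open>S \<noteq> S'\<close> by (auto simp: tessellation_def pairwise_def)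
  qed
  have absorb: "\<exists>k. U \<subseteq> \<Union> (F k)" if "bounded U" for U
    using inflated_tile_absorbs[OF int[folded T_def] that s(1)] F_tess(1)
    by (simp add: tessellation_def)
  have "tiling \<S>"
    unfolding tiling_def tessellation_def
  proof (intro conjI)
    show "\<forall>S\<in>\<S>. tile S" using tiles tile_scheme_tile by blast
    show "pairwise (\<lambda>S S'. interior S \<inter> interior S' = {}) \<S>"
      using disj by (auto simp: pairwise_def)
    have "x \<in> \<Union>\<S>" for x using absorb[of "{x}"] by (auto simp: \<S>_def)
    then show "\<Union>\<S> = UNIV" by blast
  qed
  moreover have "limit_of_generated \<sigma> P" if P: "sub_patch P \<S>" for P
  proof -
    obtain U where U: "tessellation P U" "bounded U"
      using P by (auto simp: sub_patch_def patch_def)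
    obtain k where k: "U \<subseteq> \<Union> (F k)" using absorb[OF U(2)] by blast
    \<comment> \<open>A tile of \<open>P\<close> lies in the support of \<open>F k\<close>, hence overlaps one of its tiles, and two
      overlapping tiles of \<open>\<S>\<close> are equal.\<close>
    have "P \<subseteq> F k"
    proof
      fix S assume S: "S \<in> P"
      then have "tile S" "S \<subseteq> \<Union> (F k)" using U(1) k by (auto simp: tessellation_def)
      then obtain S' where S': "S' \<in> F k" "interior S \<inter> interior S' \<noteq> {}"
        using tile_meets_cover F_tess[of k] unfolding tessellation_def by metis
      then have "S' = S"
        using disj[of S S'] S P by (auto simp: sub_patch_def \<S>_def)
      then show "S \<in> F k" using S' by simp
    qed
    moreover have "F k = translate (exp (real k * s) *\<^sub>R p) ` flow_tile \<sigma> (real k * s) (prototile \<sigma> 0)"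
      unfolding F_def T_def by (rule flow_tile_translate[OF prototile_scheme_tile[OF n]])
    moreover have "flow_tile \<sigma> (real k * s) (prototile \<sigma> 0) \<in> generating_patches \<sigma>"
      using n s by (force simp: generating_patches_def)
    ultimately show ?thesis
      using limit_of_generated_translated P unfolding sub_patch_def by metis
  qed
  ultimately have "\<S> \<in> tiling_space \<sigma>"
    using tiles scheme_tile_scale_le_1 by (auto simp: tiling_space_def)
  then show ?thesis using fixed s(1) by blast
qed

end
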